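(* Let $X$ and $Y$ be bounded distributive lattices, let $n\geqslant 1$ be an integer, let $f\colon X^n\to Y$ be a function, and assume that its diagonal section $\delta_f$ is a lattice homomorphism. Then, under the axiom of choice, $f$ is a transformed polynomial function if and only if it is a quasi-idempotent quasi-polynomial function.
   Context: $X$ and $Y$ are arbitrary, possibly different, bounded distributive lattices, with operations $\wedge,\vee$ and least and greatest elements denoted $0$ and $1$ (in either lattice). Write $[n]=\{1,\ldots,n\}$ and $\mathrm{med}(a,b,c)=(a\wedge b)\vee(b\wedge c)\vee(c\wedge a)$. A lattice homomorphism is a map preserving $\wedge$ and $\vee$ (it is not required to preserve $0$ and $1$). For a bounded distributive lattice $L$, a (lattice) polynomial function $p\colon L^n\to L$ is any map which can be obtained as a composition of the lattice operations $\wedge$ and $\vee$, the projections $\mathbf{x}\mapsto x_i$ ($i\in[n]$), and the constant functions $\mathbf{x}\mapsto c$ ($c\in L$). $f\colon X^n\to Y$ is a transformed polynomial function if there exist a polynomial function $p\colon X^n\to X$ and a function $\psi\colon X\to Y$ such that $f=\psi\circ p$. $f\colon X^n\to Y$ is a quasi-polynomial function if there exist a polynomial function $p\colon Y^n\to Y$ and a unary function $\varphi\colon X\to Y$ satisfying $\varphi(x)=\mathrm{med}(\varphi(0),\varphi(x),\varphi(1))$ for every $x\in X$, such that $f(x_1,\ldots,x_n)=p(\varphi(x_1),\ldots,\varphi(x_n))$ for all $x_1,\ldots,x_n\in X$. The diagonal section of $f$ is $\delta_f\colon X\to Y$, $\delta_f(x)=f(x,\ldots,x)$. $f$ is quasi-idempotent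 if $\mathcal{R}_{\delta_f}=\mathcal{R}_f$, where $\mathcal{R}_g$ denotes the range (set of values) of a function $g$. *)

theory Defs
  imports "HOL-Analysis.Finite_Cartesian_Product"
begin

text \<open>
  A bounded distributive lattice is a type of sort \<open>{distrib_lattice, bounded_lattice}\<close>;
  the bounds 0 and 1 are \<open>bot\<close> and \<open>top\<close>, and the one-element lattice is included.
  The power \<open>X\<^sup>n\<close> is \<open>'a ^ 'n\<close> with \<open>n = CARD('n) \<ge> 1\<close>.
\<close>

definition med :: "'a::lattice \<Rightarrow> 'a \<Rightarrow> 'a \<Rightarrow> 'a" where
  "med a b c = sup (sup (inf a b) (inf b c)) (inf c a)"

text \<open>Homomorphisms need not preserve \<open>bot\<close> and \<open>top\<close>.\<close>

definition lattice_hom :: "('a::lattice \<Rightarrow> 'b::lattice) \<Rightarrow> bool" where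
  "lattice_hom h \<longleftrightarrow>
     (\<forall>x y. h (inf x y) = inf (h x) (h y)) \<and> (\<forall>x y. h (sup x y) = sup (h x) (h y))"

inductive polynomial_fun ::
  "('a::{distrib_lattice, bounded_lattice} ^ 'n::finite \<Rightarrow> 'a) \<Rightarrow> bool" where
  proj: "polynomial_fun (\<lambda>x. x $ i)"
| const: "polynomial_fun (\<lambda>x. c)"
| inf: "polynomial_fun p \<Longrightarrow> polynomial_fun q \<Longrightarrow> polynomial_fun (\<lambda>x. inf (p x) (q x))"
| sup: "polynomial_fun p \<Longrightarrow> polynomial_fun q \<Longrightarrow> polynomial_fun (\<lambda>x. sup (p x) (q x))"

definition transformed_polynomial_fun ::
  "('a::{distrib_lattice, bounded_lattice} ^ 'n::finite \<Rightarrow>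
    'b::{distrib_lattice, bounded_lattice}) \<Rightarrow> bool" where
  "transformed_polynomial_fun f \<longleftrightarrow>
     (\<exists>(p :: 'a ^ 'n \<Rightarrow> 'a) (\<psi> :: 'a \<Rightarrow> 'b). polynomial_fun p \<and> f = \<psi> \<circ> p)"

definition quasi_polynomial_fun ::
  "('a::{distrib_lattice, bounded_lattice} ^ 'n::finite \<Rightarrow>
    'b::{distrib_lattice, bounded_lattice}) \<Rightarrow> bool" where
  "quasi_polynomial_fun f \<longleftrightarrow>
     (\<exists>(p :: 'b ^ 'n \<Rightarrow> 'b) (\<phi> :: 'a \<Rightarrow> 'b).
        polynomial_fun p \<and>
        (\<forall>x. \<phi> x = med (\<phi> bot) (\<phi> x) (\<phi> top)) \<and>
        (\<forall>x. f x = p (\<chi> i. \<phi> (x $ i))))"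

definition diagonal_section :: "('a ^ 'n::finite \<Rightarrow> 'b) \<Rightarrow> 'a \<Rightarrow> 'b" where
  "diagonal_section f x = f (\<chi> i. x)"

definition quasi_idempotent :: "('a ^ 'n::finite \<Rightarrow> 'b) \<Rightarrow> bool" where
  "quasi_idempotent f \<longleftrightarrow> range (diagonal_section f) = range f"

end

theory Submission
  imports Defs
begin

text \<open>
  Write \<open>\<delta>\<close> for the diagonal section of \<open>f\<close>. Both properties turn out to say that
  \<open>f\<close> and \<open>\<delta>\<close> are tied together by a polynomial function: on the one side
  \<open>f = \<delta> \<circ> q\<close> with \<open>q\<close> over \<open>X\<close>, on the other side \<open>f x = p (\<delta> x\<^sub>1, \<dots>, \<delta> x\<^sub>n)\<close>
  with \<open>p\<close> over \<open>Y\<close>.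

  The common source is that polynomial functions are affine along chords
  (\<open>polynomial_fun_affine\<close>): the term \<open>u \<squnion> (c \<sqinter> v)\<close> with \<open>u \<le> v\<close> is carried to
  \<open>p u \<squnion> (c \<sqinter> p v)\<close>. On the diagonal this gives
  \<open>p (c, \<dots>, c) = p 0 \<squnion> (c \<sqinter> p 1)\<close>, so \<open>p\<close> fixes each of its own values \<open>c\<close>
  in the sense \<open>p (c, \<dots>, c) = c\<close>; in a single coordinate it gives the Shannon
  decomposition.

  If \<open>f = \<psi> \<circ> p\<close>, the first consequence yields \<open>f = \<delta> \<circ> p\<close>. Quasi-idempotence is then
  immediate, and the homomorphism \<open>\<delta>\<close> can be pushed through \<open>p\<close> down to the variables, its
  constants \<open>c\<close> becoming \<open>\<delta> c\<close>.

  Conversely let \<open>f x = p (\<phi> x\<^sub>1, \<dots>, \<phi> x\<^sub>n)\<close>. Here \<open>\<delta>\<close> is \<open>\<phi>\<close> truncated to the interval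
  \<open>[p 0, p 1]\<close>, and a polynomial function does not notice this truncation of its arguments, so
  \<open>\<phi>\<close> may be replaced by \<open>\<delta>\<close>. As \<open>\<delta>\<close> is monotone, the Shannon decomposition gives
  \<open>f x = f (x[k := 0]) \<squnion> (\<delta> x\<^sub>k \<sqinter> f (x[k := 1]))\<close>. Applying it to one coordinate after another
  builds \<open>f\<close> from values of \<open>f\<close>, which lie in the range of \<open>\<delta>\<close> by quasi-idempotence, and from
  the \<open>\<delta> x\<^sub>k\<close>; the homomorphism \<open>\<delta>\<close> can therefore be pulled out in front. Only finitely many
  preimages under \<open>\<delta>\<close> are selected, one for each vector of bounds.
\<close>

section \<open>Polynomial functions on distributive lattices\<close>

lemma polynomial_fun_mono:
  assumes "polynomial_fun p" and "\<And>i. u $ i \<le> v $ i"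
  shows "p u \<le> p v"
  using assms(1)
proof induction
  case (inf p q)
  from inf.IH show ?case by (rule inf_mono)
next
  case (sup p q)
  from sup.IH show ?case by (rule sup_mono)
qed (use assms(2) in auto)

text \<open>
  The maps of the form \<open>c \<mapsto> a \<squnion> (c \<sqinter> b)\<close> with \<open>a \<le> b\<close> are closed under pointwise meets: of the two
  mixed terms of the expansion, \<open>a \<sqinter> c \<sqinter> b'\<close> lies below \<open>c \<sqinter> b \<sqinter> b'\<close> because \<open>a \<le> b\<close>, and
  symmetrically for the other.
\<close>

lemma inf_sup_inf_distrib:
  fixes a :: "'a::distrib_lattice"
  assumes "a \<le> b" and "a' \<le> b'"
  shows "inf (sup a (inf c b)) (sup a' (inf c b')) = sup (inf a a') (inf c (inf b b'))"
proof (rule order.antisym)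
  have "inf a (inf c b') \<le> inf c (inf b b')" and "inf (inf c b) a' \<le> inf c (inf b b')"
    using assms by (auto intro: le_infI1 le_infI2)
  moreover have "inf (inf c b) (inf c b') \<le> inf c (inf b b')"
    by (simp add: le_infI1 le_infI2)
  ultimately show "inf (sup a (inf c b)) (sup a' (inf c b')) \<le> sup (inf a a') (inf c (inf b b'))"
    by (simp add: inf_sup_distrib1 inf_sup_distrib2 le_supI2)
  show "sup (inf a a') (inf c (inf b b')) \<le> inf (sup a (inf c b)) (sup a' (inf c b'))"
    by (simp add: le_infI1 le_infI2 le_supI1 le_supI2)
qed

text \<open>
  The condition on \<open>w\<close> is imposed coordinatewise so that the chord from \<open>u\<close> to \<open>v\<close> can be the whole
  diagonal or can move in one coordinate only.
\<close>

lemma polynomial_fun_affine: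
  assumes "polynomial_fun p"
    and le: "\<And>i. u $ i \<le> v $ i"
    and w: "\<And>i. w $ i = sup (u $ i) (inf c (v $ i))"
  shows "p w = sup (p u) (inf c (p v))"
  using assms(1)
proof induction
  case (proj i)
  show ?case by (rule w)
next
  case (const d)
  show ?case by (simp add: sup_absorb1)
next
  case (inf p q)
  then show ?case
    using inf_sup_inf_distrib polynomial_fun_mono[OF _ le] by metis
next
  case (sup p q)
  then show ?case by (simp add: inf_sup_distrib1 ac_simps)
qed

lemma polynomial_fun_diagonal:
  assumes "polynomial_fun p"
  shows "p (\<chi> i. c) = sup (p (\<chi> i. bot)) (inf c (p (\<chi> i. top)))"
  using assms by (rule polynomial_fun_affine) simp_all

lemma polynomial_fun_truncate_value:
  assumes "polynomial_fun p"
  shows "sup (p (\<chi> i. bot)) (inf (p x) (p (\<chi> i. top))) = p x"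
proof -
  have "p (\<chi> i. bot) \<le> p x" and "p x \<le> p (\<chi> i. top)"
    using assms by (auto intro: polynomial_fun_mono)
  then show ?thesis by (simp add: sup_absorb2 inf_absorb1)
qed

text \<open>
  The truncation \<open>c \<mapsto> p (c, \<dots>, c)\<close> to the interval \<open>[p 0, p 1]\<close> is an idempotent lattice
  endomorphism \<open>h\<close>, so truncating the arguments of any polynomial function makes no difference
  once its value is truncated as well; and the values of \<open>p\<close> are already fixed by \<open>h\<close>.
\<close>

lemma polynomial_fun_truncate_arguments:
  assumes p: "polynomial_fun p"
  shows "p (\<chi> i. p (\<chi> j. y $ i)) = p y"
proof -
  define h where "h c = sup (p (\<chi> i. bot)) (inf c (p (\<chi> i. top)))" for c
  have h_inf: "h (inf c d) = inf (h c) (h d)" for c d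
    by (simp add: h_def sup_inf_distrib1 ac_simps)
  have h_sup: "h (sup c d) = sup (h c) (h d)" for c d
    by (simp add: h_def inf_sup_distrib2 ac_simps)
  \<comment> \<open>\<open>h c\<close> is a value of \<open>p\<close>, namely the one at \<open>(c, \<dots>, c)\<close>\<close>
  have h_idem: "h (h c) = h c" for c
    using polynomial_fun_truncate_value[OF p, of "\<chi> i. c"]
    by (simp add: h_def polynomial_fun_diagonal[OF p, of c])
  have trunc: "h (q (\<chi> i. h (y $ i))) = h (q y)" if "polynomial_fun q" for q
    using that by induction (simp_all add: h_inf h_sup h_idem)
  have h_value: "h (p x) = p x" for x
    unfolding h_def by (rule polynomial_fun_truncate_value[OF p])
  have "p (\<chi> j. c) = h c" for c
    unfolding h_def by (rule polynomial_fun_diagonal[OF p])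
  then show ?thesis using trunc[OF p] by (simp add: h_value)
qed

section \<open>Lattice homomorphisms and polynomial functions\<close>

lemma lattice_hom_mono:
  assumes "lattice_hom h" and "x \<le> y"
  shows "h x \<le> h y"
  using assms unfolding lattice_hom_def by (metis inf.absorb_iff1)

lemma lattice_hom_polynomial_fun:
  assumes h: "lattice_hom h" and "polynomial_fun p"
  shows "\<exists>q. polynomial_fun q \<and> (\<forall>x. h (p x) = q (\<chi> i. h (x $ i)))"
  using assms(2)
proof induction
  case (proj i)
  show ?case by (rule exI[of _ "\<lambda>y. y $ i"]) (simp add: polynomial_fun.proj)
next
  case (const c)
  show ?case by (rule exI[of _ "\<lambda>y. h c"]) (simp add: polynomial_fun.const)
next
  case (inf p1 p2)
  then obtain q1 q2 where "polynomial_fun q1" "\<And>x. h (p1 x) = q1 (\<chi> i. h (x $ i))"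
    and "polynomial_fun q2" "\<And>x. h (p2 x) = q2 (\<chi> i. h (x $ i))" by blast
  then show ?case using h
    by (intro exI[of _ "\<lambda>y. inf (q1 y) (q2 y)"]) (simp add: polynomial_fun.inf lattice_hom_def)
next
  case (sup p1 p2)
  then obtain q1 q2 where "polynomial_fun q1" "\<And>x. h (p1 x) = q1 (\<chi> i. h (x $ i))"
    and "polynomial_fun q2" "\<And>x. h (p2 x) = q2 (\<chi> i. h (x $ i))" by blast
  then show ?case using h
    by (intro exI[of _ "\<lambda>y. sup (q1 y) (q2 y)"]) (simp add: polynomial_fun.sup lattice_hom_def)
qed

text \<open>
  A Shannon decomposition along \<open>h\<close> recovers \<open>f\<close> from its values by freeing one coordinate at a
  time. The coordinates outside \<open>S\<close> are frozen at an arbitrary vector \<open>c\<close>, which must vary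
  in the induction because freeing the coordinate \<open>k\<close> uses both \<open>c[k := 0]\<close> and \<open>c[k := 1]\<close>.
\<close>

lemma polynomial_fun_from_shannon:
  fixes f :: "'a::{distrib_lattice, bounded_lattice} ^ 'n::finite \<Rightarrow> 'b::lattice"
  assumes h: "lattice_hom h" and range_le: "range f \<subseteq> range h"
    and shannon: "\<And>x k. f x = sup (f (\<chi> i. if i = k then bot else x $ i))
                              (inf (h (x $ k)) (f (\<chi> i. if i = k then top else x $ i)))"
  shows "\<exists>q. polynomial_fun q \<and> f = h \<circ> q"
proof -
  have freed: "\<exists>q. polynomial_fun q \<and> (\<forall>x. f (\<chi> i. if i \<in> S then x $ i else c $ i) = h (q x))"
    if "finite S" for S c
    using that
  proof (induction arbitrary: c)
    case empty
    obtain d where "f c = h d" using range_le by blast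
    then show ?case by (intro exI[of _ "\<lambda>x. d"]) (simp add: polynomial_fun.const)
  next
    case (insert k S)
    define c0 where "c0 = (\<chi> i. if i = k then bot else c $ i)"
    define c1 where "c1 = (\<chi> i. if i = k then top else c $ i)"
    obtain q0 where q0: "polynomial_fun q0"
      "\<And>x. f (\<chi> i. if i \<in> S then x $ i else c0 $ i) = h (q0 x)" using insert.IH[of c0] by auto
    obtain q1 where q1: "polynomial_fun q1"
      "\<And>x. f (\<chi> i. if i \<in> S then x $ i else c1 $ i) = h (q1 x)" using insert.IH[of c1] by auto
    have "f (\<chi> i. if i \<in> insert k S then x $ i else c $ i)
        = h (sup (q0 x) (inf (x $ k) (q1 x)))" for x
    proof -
      define y where "y = (\<chi> i. if i \<in> insert k S then x $ i else c $ i)"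
      have "(\<chi> i. if i = k then bot else y $ i) = (\<chi> i. if i \<in> S then x $ i else c0 $ i)"
        and "(\<chi> i. if i = k then top else y $ i) = (\<chi> i. if i \<in> S then x $ i else c1 $ i)"
        using insert.hyps by (auto simp: y_def c0_def c1_def vec_eq_iff)
      then have "f y = sup (h (q0 x)) (inf (h (y $ k)) (h (q1 x)))"
        using shannon[of y k] by (simp add: q0(2) q1(2))
      then show ?thesis using h by (simp add: y_def lattice_hom_def)
    qed
    moreover have "polynomial_fun (\<lambda>x. sup (q0 x) (inf (x $ k) (q1 x)))"
      by (intro polynomial_fun.intros q0 q1)
    ultimately show ?case by blast
  qed
  obtain q where "polynomial_fun q" "\<And>x. f x = h (q x)"
    using freed[of UNIV] by auto
  then show ?thesis by (auto simp: fun_eq_iff)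
qed

section \<open>Transformed and quasi-polynomial functions\<close>

text \<open>
  The outer function may be taken to be the diagonal section, since \<open>p x = p (c, \<dots>, c)\<close> for
  \<open>c = p x\<close>.
\<close>

lemma transformed_polynomial_funE:
  assumes "transformed_polynomial_fun f"
  obtains p where "polynomial_fun p" and "f = diagonal_section f \<circ> p"
proof -
  obtain p \<psi> where p: "polynomial_fun p" and f: "f = \<psi> \<circ> p"
    using assms unfolding transformed_polynomial_fun_def by blast
  have "p (\<chi> i. p x) = p x" for x
    using polynomial_fun_diagonal[OF p] polynomial_fun_truncate_value[OF p] by (rule trans)
  then have "f = diagonal_section f \<circ> p"
    by (simp add: f diagonal_section_def fun_eq_iff)
  with p show thesis by (rule that)
qed

text \<open>
  The inner function may be taken to be the diagonal section, since the latter is \<open>\<phi>\<close> truncated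
  to the interval \<open>[p 0, p 1]\<close>.
\<close>

lemma quasi_polynomial_funE:
  assumes "quasi_polynomial_fun f"
  obtains p where "polynomial_fun p" and "\<And>x. f x = p (\<chi> i. diagonal_section f (x $ i))"
proof -
  obtain p \<phi> where p: "polynomial_fun p" and f: "\<And>x. f x = p (\<chi> i. \<phi> (x $ i))"
    using assms unfolding quasi_polynomial_fun_def by blast
  have "f x = p (\<chi> i. diagonal_section f (x $ i))" for x
    using polynomial_fun_truncate_arguments[OF p, of "\<chi> i. \<phi> (x $ i)"]
    by (simp add: f diagonal_section_def)
  with p show thesis by (rule that)
qed

theorem theorem22:
  fixes f :: "'a::{distrib_lattice, bounded_lattice} ^ 'n::finite \<Rightarrow>
              'b::{distrib_lattice, bounded_lattice}"
  assumes "lattice_hom (diagonal_section f)"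
  shows "transformed_polynomial_fun f \<longleftrightarrow> quasi_idempotent f \<and> quasi_polynomial_fun f"
proof (intro iffI conjI)
  let ?d = "diagonal_section f"
  assume "transformed_polynomial_fun f"
  then obtain p where p: "polynomial_fun p" and f: "f = ?d \<circ> p"
    by (rule transformed_polynomial_funE)
  have "range f \<subseteq> range ?d" by (subst f) auto
  moreover have "range ?d \<subseteq> range f" by (auto simp: diagonal_section_def)
  ultimately show "quasi_idempotent f" by (simp add: quasi_idempotent_def)
  obtain q where "polynomial_fun q" and q: "\<And>x. ?d (p x) = q (\<chi> i. ?d (x $ i))"
    using lattice_hom_polynomial_fun[OF assms p] by blast
  moreover have "f x = q (\<chi> i. ?d (x $ i))" for x
    using q fun_cong[OF f, of x] by simp
  moreover have "?d x = med (?d bot) (?d x) (?d top)" for x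
  proof -
    have "?d bot \<le> ?d x" and "?d x \<le> ?d top"
      using lattice_hom_mono[OF assms] by simp_all
    then have "inf (?d bot) (?d x) = ?d bot" and "inf (?d x) (?d top) = ?d x"
      and "inf (?d top) (?d bot) = ?d bot" and "sup (?d bot) (?d x) = ?d x"
      and "sup (?d x) (?d bot) = ?d x"
      by (auto simp: inf_absorb1 inf_absorb2 sup_absorb1 sup_absorb2)
    then show ?thesis by (simp add: med_def)
  qed
  ultimately show "quasi_polynomial_fun f"
    unfolding quasi_polynomial_fun_def by blast
next
  let ?d = "diagonal_section f"
  assume "quasi_idempotent f \<and> quasi_polynomial_fun f"
  then have range_le: "range f \<subseteq> range ?d" and quasi: "quasi_polynomial_fun f"
    by (auto simp: quasi_idempotent_def)
  obtain p where p: "polynomial_fun p" and f: "\<And>x. f x = p (\<chi> i. ?d (x $ i))"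
    using quasi by (rule quasi_polynomial_funE) blast
  have "f x = sup (f (\<chi> i. if i = k then bot else x $ i))
                (inf (?d (x $ k)) (f (\<chi> i. if i = k then top else x $ i)))" for x k
  proof -
    have le: "?d bot \<le> ?d z" "?d z \<le> ?d top" for z
      using lattice_hom_mono[OF assms] by simp_all
    \<comment> \<open>the chord moves in coordinate \<open>k\<close> only, from \<open>\<delta> 0\<close> to \<open>\<delta> 1\<close>\<close>
    have "p (\<chi> i. ?d (x $ i))
        = sup (p (\<chi> i. ?d (if i = k then bot else x $ i)))
            (inf (?d (x $ k)) (p (\<chi> i. ?d (if i = k then top else x $ i))))"
      by (rule polynomial_fun_affine[OF p])
        (auto simp: le sup_absorb1 sup_absorb2 inf_absorb1)
    then show ?thesis by (simp add: f[of "vec_lambda _"] f[of x])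
  qed
  then obtain q where "polynomial_fun q" and "f = ?d \<circ> q"
    using polynomial_fun_from_shannon[OF assms range_le] by blast
  then show "transformed_polynomial_fun f"
    unfolding transformed_polynomial_fun_def by blast
qed

end
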